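(* We have $$\sum_{k=1}^\infty \frac{1}{k^2 \binom{2k}{k}^2} \left( \frac{30k-11}{k(2k-1)} (H_{2k-1}^{(3)} + 2 H_{k-1}^{(3)}) + \frac{27}{8k^4} \right) = 4 \zeta(3)^2.$$
   Context: For integers $m\ge1$ and $n\ge0$, $H_n^{(m)}=\sum_{0<j\le n}\frac1{j^m}$ denotes the harmonic number of order $m$ (so $H_0^{(m)}=0$). $\zeta$ is the Riemann zeta function. *)

theory Defs
  imports Complex_Main
begin

text \<open>Harmonic numbers of order \<open>m\<close>: the argument order is (order, index).\<close>

definition harmonic_num :: "nat \<Rightarrow> nat \<Rightarrow> real" where
  "harmonic_num m n = (\<Sum>j\<in>{0<..n}. 1 / real j ^ m)"

text \<open>
  The Riemann zeta function on the real half-line \<open>s > 1\<close>, where it is given by its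
  Dirichlet series; its analytic continuation is not modelled, so values at \<open>s \<le> 1\<close>
  carry no meaning.
\<close>

definition riemann_zeta :: "real \<Rightarrow> real" where
  "riemann_zeta s = (\<Sum>n. 1 / real (Suc n) powr s)"

end

theory Submission
  imports Defs "HOL-Analysis.Summation_Tests"
begin

text \<open>
  Up to a factor of two, the identity is the coefficient of \<open>y\<close> in a hypergeometric transformation
  that depends on a parameter \<open>y\<close>. The slowly convergent side of that transformation is the series with terms
  \<open>2/(k\<^sup>3 - y) \<cdot> \<Prod>\<^bsub>j<k\<^esub> (j\<^sup>3 + y)/(j\<^sup>3 - y)\<close> for \<open>k \<ge> 1\<close>. It telescopes to
  \<open>(1/y) \<cdot> (\<Prod>\<^bsub>j\<ge>1\<^esub> (j\<^sup>3 + y)/(j\<^sup>3 - y) - 1) = 2 \<zeta>(3) + 2 \<zeta>(3)\<^sup>2 y + \<dots>\<close>,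
  and this is where the square of \<open>\<zeta>(3)\<close> comes from.

  The rapidly convergent side is produced by a WZ pair \<open>F\<close>, \<open>G\<close> (lemma \<open>wz_pair\<close>), that is, two
  functions with \<open>F(n+1,k) - F(n,k) = G(n,k+1) - G(n,k)\<close>. Here \<open>F(0,k)\<close> is the term above, with
  \<open>k+1\<close> in place of \<open>k\<close>. Summing over a rectangle and letting its sides grow turns the sum of
  \<open>F(0,k)\<close> over \<open>k\<close> into the sum of \<open>G(n,0)\<close> over \<open>n\<close>, and \<open>G(n,0)\<close> contains the inverse square of a
  central binomial coefficient.

  The coefficient of \<open>y\<close> is extracted before any limit is taken: both sides of the WZ equation are
  differentiated at \<open>y = 0\<close>. This gives a WZ pair for the first-order coefficients
  (lemma \<open>wz_pair_first_order\<close>), in which the logarithmic derivatives of products of factors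
  \<open>j\<^sup>3 \<plusminus> y\<close> have become harmonic numbers of order three. For this pair, the sum of \<open>F\<close> along
  the side \<open>n = 0\<close> telescopes to twice the square of a harmonic number (lemma \<open>wzF1_0_sum\<close>), the
  sides opposite to \<open>n = 0\<close> and \<open>k = 0\<close> vanish in the limit (lemmas \<open>wzF1_bounds\<close> and
  \<open>wzG1_tendsto_0\<close>), and \<open>G(n,0)\<close> is half the summand of the theorem (lemma \<open>wzG1_0\<close>).
\<close>

section \<open>Harmonic numbers and zeta values\<close>

lemma harmonic_num_0 [simp]: "harmonic_num m 0 = 0"
  by (simp add: harmonic_num_def)

lemma harmonic_num_Suc [simp]:
  "harmonic_num m (Suc n) = harmonic_num m n + 1 / real (Suc n) ^ m"
proof -
  have "{0<..Suc n} = insert (Suc n) {0<..n}" by auto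
  then show ?thesis by (simp add: harmonic_num_def)
qed

lemma harmonic_num_nonneg: "harmonic_num m n \<ge> 0"
  by (simp add: harmonic_num_def sum_nonneg)

lemma harmonic_num_eq_sum: "harmonic_num m n = (\<Sum>i<n. 1 / real (Suc i) ^ m)"
  by (induction n) auto

lemma summable_inverse_Suc_power:
  assumes "m \<ge> 2"
  shows "summable (\<lambda>i. 1 / real (Suc i) ^ m)"
  using inverse_power_summable[OF assms, where 'a = real]
  by (subst (asm) summable_Suc_iff[symmetric]) (simp add: inverse_eq_divide)

lemma zeta_series_sums:
  assumes "m \<ge> 2"
  shows "(\<lambda>i. 1 / real (Suc i) ^ m) sums riemann_zeta (real m)"
proof -
  have "riemann_zeta (real m) = (\<Sum>i. 1 / real (Suc i) ^ m)"
    by (simp add: riemann_zeta_def powr_realpow)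
  then show ?thesis
    using summable_inverse_Suc_power[OF assms] by (simp add: summable_sums)
qed

lemma harmonic_num_tendsto_zeta:
  assumes "m \<ge> 2"
  shows "harmonic_num m \<longlonglongrightarrow> riemann_zeta (real m)"
  using zeta_series_sums[OF assms]
  by (simp add: sums_def harmonic_num_eq_sum[abs_def])

lemma harmonic_num_le_zeta:
  assumes "m \<ge> 2"
  shows "harmonic_num m n \<le> riemann_zeta (real m)"
  using zeta_series_sums[OF assms] sum_le_suminf[of "\<lambda>i. 1 / real (Suc i) ^ m" "{..<n}"]
  by (auto simp: harmonic_num_eq_sum sums_iff)

section \<open>A WZ pair depending on a parameter\<close>

definition cube_prod :: "real \<Rightarrow> nat \<Rightarrow> real" where
  "cube_prod y n = (\<Prod>j<n. real (Suc j) ^ 3 + y)"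

lemma cube_prod_0 [simp]: "cube_prod y 0 = 1"
  and cube_prod_Suc [simp]: "cube_prod y (Suc n) = cube_prod y n * ((real n + 1) ^ 3 + y)"
  by (simp_all add: cube_prod_def add.commute)

lemma cube_prod_zero: "cube_prod 0 n = fact n ^ 3"
  by (induction n) (simp_all add: power_mult_distrib mult.commute add.commute)

lemma has_real_derivative_cube_prod:
  "((\<lambda>y. cube_prod y n) has_real_derivative fact n ^ 3 * harmonic_num 3 n) (at 0)"
proof (induction n)
  case (Suc n)
  have "((\<lambda>y. cube_prod y n * ((real n + 1) ^ 3 + y)) has_real_derivative
      fact n ^ 3 * harmonic_num 3 n * ((real n + 1) ^ 3 + 0) + 1 * cube_prod 0 n) (at 0)"
    by (intro DERIV_mult Suc) (auto intro!: derivative_eq_intros)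
  moreover have "fact n ^ 3 * harmonic_num 3 n * ((real n + 1) ^ 3 + 0) + 1 * cube_prod 0 n
      = fact (Suc n) ^ 3 * harmonic_num 3 (Suc n)"
    by (simp add: cube_prod_zero power_mult_distrib divide_simps) (simp add: algebra_simps)
  ultimately show ?case by simp
qed simp

text \<open>
  Up to a factor linear in \<open>n\<close> and \<open>k\<close>, this is the summand of a well-poised series. With
  \<open>y = x\<^sup>3\<close> and \<open>\<omega>\<close> a primitive cube root of unity, the function \<open>wzF\<close> below is a factor depending
  only on \<open>n\<close> times \<open>a + 2k\<close> times the product of \<open>(u)\<^sub>k / (1+a-u)\<^sub>k\<close> over the four parameters
  \<open>u = n+1+x\<close>, \<open>n+1+\<omega>x\<close>, \<open>n+1+\<omega>\<^sup>2x\<close>, \<open>2n+1\<close>, where \<open>a = 3n+2\<close> and \<open>(u)\<^sub>k\<close> is the rising factorial.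
  The first three parameters are chosen so that \<open>x\<close> enters only through its cube. The rates \<open>1\<close>,
  \<open>1\<close>, \<open>1\<close>, \<open>2\<close> and \<open>3\<close> at which the parameters and \<open>a\<close> grow with \<open>n\<close> are those that lead to
  squares of central binomial coefficients. The factors of \<open>cube_prod (- y)\<close> are \<open>j\<^sup>3 - y\<close>.
\<close>

definition wz_kernel :: "real \<Rightarrow> nat \<Rightarrow> nat \<Rightarrow> real" where
  "wz_kernel y n k = fact (2 * n + k) * cube_prod y n * cube_prod y (n + k)
     / (fact (n + k + 1) * fact n * cube_prod (- y) (2 * n + k + 1))"

definition kernel_log_deriv :: "nat \<Rightarrow> nat \<Rightarrow> real" where
  "kernel_log_deriv n k = harmonic_num 3 n + harmonic_num 3 (n + k) + harmonic_num 3 (2 * n + k + 1)"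

text \<open>
  The factors \<open>j\<^sup>3 - y\<close> stand in the denominator, so the signs cancel and all three harmonic numbers
  are added.
\<close>

lemma has_real_derivative_wz_kernel:
  "((\<lambda>y. wz_kernel y n k) has_real_derivative wz_kernel 0 n k * kernel_log_deriv n k) (at 0)"
proof -
  define a where "a = fact (2 * n + k) / (fact (n + k + 1) * fact n :: real)"
  let ?m = "2 * n + k + 1"
  have kernel_eq: "wz_kernel y n k = a * (cube_prod y n * cube_prod y (n + k) / cube_prod (- y) ?m)" for y
    by (simp add: wz_kernel_def a_def)
  have minus: "((\<lambda>y. cube_prod (- y) ?m) has_real_derivative
      fact ?m ^ 3 * harmonic_num 3 ?m * (- 1)) (at 0)"
    by (rule DERIV_chain2[where g = uminus])
       (use has_real_derivative_cube_prod[of ?m] in \<open>auto intro!: derivative_eq_intros\<close>)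
  let ?D = "a * (((fact n ^ 3 * harmonic_num 3 n * cube_prod 0 (n + k)
             + fact (n + k) ^ 3 * harmonic_num 3 (n + k) * cube_prod 0 n) * cube_prod (- 0) ?m
            - cube_prod 0 n * cube_prod 0 (n + k) * (fact ?m ^ 3 * harmonic_num 3 ?m * (- 1)))
           / (cube_prod (- 0) ?m * cube_prod (- 0) ?m))"
  have "((\<lambda>y. wz_kernel y n k) has_real_derivative ?D) (at 0)"
    unfolding kernel_eq
    by (intro DERIV_cmult DERIV_divide DERIV_mult has_real_derivative_cube_prod minus)
       (simp add: cube_prod_zero)
  moreover have "a * (((u * h\<^sub>1 * v + v * h\<^sub>2 * u) * w - u * v * (w * h\<^sub>3 * (- 1))) / (w * w))
      = a * (u * v / w) * (h\<^sub>1 + h\<^sub>2 + h\<^sub>3)" if "w \<noteq> 0" for u v w h\<^sub>1 h\<^sub>2 h\<^sub>3 :: real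
    using that by (simp add: field_simps)
  then have "?D = wz_kernel 0 n k * kernel_log_deriv n k"
    unfolding kernel_eq cube_prod_zero minus_zero kernel_log_deriv_def by this simp
  ultimately show ?thesis by simp
qed

text \<open>
  The numerator of the WZ certificate is \<open>cert0 p m + y cert1 p m\<close> in the variables \<open>p = n + 1\<close> and
  \<open>m = 2n + k + 2\<close>. It solves the linear system that the WZ equation imposes on the coefficients of
  a polynomial of degree five, where \<open>y\<close> has weight three.
\<close>

definition cert0 :: "real \<Rightarrow> real \<Rightarrow> real" where
  "cert0 p m = (m - 1) * (m ^ 4 + 2 * p ^ 3 * m - p ^ 4) - p * (p - 1) * m ^ 3"

definition cert1 :: "real \<Rightarrow> real \<Rightarrow> real" where
  "cert1 p m = m * (m - 1) - p * (m - p)"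

definition wzF :: "real \<Rightarrow> nat \<Rightarrow> nat \<Rightarrow> real" where
  "wzF y n k = (3 * real n + 2 * real k + 2) * wz_kernel y n k"

definition wzG :: "real \<Rightarrow> nat \<Rightarrow> nat \<Rightarrow> real" where
  "wzG y n k = (let p = real n + 1; m = 2 * real n + real k + 2 in
     wz_kernel y n k * (cert0 p m + y * cert1 p m) / (p * (m ^ 3 - y)))"

lemma kernel_Suc_right:
  fixes y :: real and n k :: nat
  defines "q \<equiv> real n + real k + 1" and "m \<equiv> 2 * real n + real k + 2"
  shows "wz_kernel y n (Suc k) = wz_kernel y n k *
    ((m - 1) * (q ^ 3 + y) / ((q + 1) * (m ^ 3 - y)))"
proof -
  have a: "fact (2 * n + Suc k) = (m - 1) * fact (2 * n + k)"
    "fact (n + Suc k + 1) = (q + 1) * (fact (n + k + 1) :: real)"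
    "cube_prod y (n + Suc k) = cube_prod y (n + k) * (q ^ 3 + y)"
    "cube_prod (- y) (2 * n + Suc k + 1) = cube_prod (- y) (2 * n + k + 1) * (m ^ 3 - y)"
    by (simp_all add: m_def q_def algebra_simps)
  show ?thesis unfolding wz_kernel_def a by (simp only: times_divide_times_eq mult_ac)
qed

lemma kernel_Suc_left:
  fixes y :: real and n k :: nat
  defines "p \<equiv> real n + 1" and "q \<equiv> real n + real k + 1"
    and "m \<equiv> 2 * real n + real k + 2"
  shows "wz_kernel y (Suc n) k = wz_kernel y n k *
    ((m - 1) * m * (p ^ 3 + y) * (q ^ 3 + y)
      / ((q + 1) * p * (m ^ 3 - y) * ((m + 1) ^ 3 - y)))"
proof -
  have e: "2 * Suc n + k = Suc (Suc (2 * n + k))" "Suc n + k + 1 = Suc (n + k + 1)"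
    "2 * Suc n + k + 1 = Suc (Suc (2 * n + k + 1))" "Suc n + k = Suc (n + k)"
    by simp_all
  have a: "fact (2 * Suc n + k) = m * (m - 1) * fact (2 * n + k)"
    "fact (Suc n + k + 1) = (q + 1) * (fact (n + k + 1) :: real)"
    "fact (Suc n) = p * (fact n :: real)"
    "cube_prod y (Suc n) = cube_prod y n * (p ^ 3 + y)"
    "cube_prod y (Suc n + k) = cube_prod y (n + k) * (q ^ 3 + y)"
    "cube_prod (- y) (2 * Suc n + k + 1) =
       cube_prod (- y) (2 * n + k + 1) * (m ^ 3 - y) * ((m + 1) ^ 3 - y)"
    unfolding e by (simp_all add: m_def q_def p_def add.commute add.left_commute)
  show ?thesis unfolding wz_kernel_def a by (simp only: times_divide_times_eq mult_ac)
qed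

text \<open>
  The WZ equation divided by \<open>wz_kernel y n k\<close> and cleared of denominators, with \<open>q = n + k + 1\<close>.
  The factors \<open>2m - p - 1\<close> and \<open>2m - p + 2\<close> are \<open>3n + 2k + 2\<close> and its value at \<open>n + 1\<close>.
\<close>

lemma wz_identity_polynomial:
  fixes p q m y :: real
  assumes "m = p + q"
  shows "(2 * m - p + 2) * ((m - 1) * m * (p ^ 3 + y) * (q ^ 3 + y))
           - (2 * m - p - 1) * ((q + 1) * p * (m ^ 3 - y) * ((m + 1) ^ 3 - y))
       = (m - 1) * (q ^ 3 + y) * (cert0 p (m + 1) + y * cert1 p (m + 1))
           - (cert0 p m + y * cert1 p m) * ((q + 1) * ((m + 1) ^ 3 - y))"
proof -
  have q: "q = m - p" using assms by simp
  show ?thesis unfolding q cert0_def cert1_def by (simp add: algebra_simps power_numeral_reduce)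
qed

lemma wz_identity_rational:
  fixes p q m y :: real
  assumes "m = p + q" "p > 0" "q > 0" "m ^ 3 - y \<noteq> 0" "(m + 1) ^ 3 - y \<noteq> 0"
  shows "(2 * m - p + 2) * ((m - 1) * m * (p ^ 3 + y) * (q ^ 3 + y)
            / ((q + 1) * p * (m ^ 3 - y) * ((m + 1) ^ 3 - y))) - (2 * m - p - 1)
       = (m - 1) * (q ^ 3 + y) / ((q + 1) * (m ^ 3 - y))
           * ((cert0 p (m + 1) + y * cert1 p (m + 1)) / (p * ((m + 1) ^ 3 - y)))
         - (cert0 p m + y * cert1 p m) / (p * (m ^ 3 - y))" (is "?l = ?r")
proof -
  let ?D = "(q + 1) * p * (m ^ 3 - y) * ((m + 1) ^ 3 - y)"
  have nz: "q + 1 \<noteq> 0" "p \<noteq> 0" "?D \<noteq> 0" using assms by auto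
  have "?l = ((2 * m - p + 2) * ((m - 1) * m * (p ^ 3 + y) * (q ^ 3 + y))
      - (2 * m - p - 1) * ?D) / ?D"
    using nz by (simp add: diff_divide_distrib)
  also have "\<dots> = ((m - 1) * (q ^ 3 + y) * (cert0 p (m + 1) + y * cert1 p (m + 1))
      - (cert0 p m + y * cert1 p m) * ((q + 1) * ((m + 1) ^ 3 - y))) / ?D"
    by (simp only: wz_identity_polynomial[OF assms(1)])
  also have "\<dots> = ?r"
  proof -
    have "(cert0 p m + y * cert1 p m) * ((q + 1) * ((m + 1) ^ 3 - y)) / ?D
        = (cert0 p m + y * cert1 p m) / (p * (m ^ 3 - y))"
      using nz assms(4,5) by (simp add: divide_simps)
    then show ?thesis by (simp add: diff_divide_distrib mult_ac)
  qed
  finally show ?thesis .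
qed

text \<open>
  The bound on \<open>y\<close> keeps every factor \<open>j\<^sup>3 - y\<close> away from zero. The quotients of the values of
  \<open>wz_kernel\<close> at neighbouring points are then rational functions, so that only an identity between
  rational functions is left.
\<close>

lemma wz_pair:
  assumes "\<bar>y\<bar> < 1"
  shows "wzF y (Suc n) k - wzF y n k = wzG y n (Suc k) - wzG y n k"
proof -
  define p q m where "p = real n + 1" and "q = real n + real k + 1"
    and "m = 2 * real n + real k + 2"
  have pos: "m = p + q" "p > 0" "q > 0" "m \<ge> 1" by (simp_all add: p_def q_def m_def)
  have "m ^ 3 - y > 0" "(m + 1) ^ 3 - y > 0"
    using one_le_power[of m 3] one_le_power[of "m + 1" 3] pos assms by linarith+
  then have nz: "m ^ 3 - y \<noteq> 0" "(m + 1) ^ 3 - y \<noteq> 0" by simp_all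
  have F: "wzF y n k = wz_kernel y n k * (2 * m - p - 1)"
    "wzF y (Suc n) k = wz_kernel y n k * ((2 * m - p + 2) *
       ((m - 1) * m * (p ^ 3 + y) * (q ^ 3 + y)
            / ((q + 1) * p * (m ^ 3 - y) * ((m + 1) ^ 3 - y))))"
    unfolding wzF_def kernel_Suc_left by (simp_all add: p_def q_def m_def algebra_simps)
  have m1: "2 * real n + real (Suc k) + 2 = m + 1" by (simp add: m_def)
  have G: "wzG y n k = wz_kernel y n k * ((cert0 p m + y * cert1 p m) / (p * (m ^ 3 - y)))"
    "wzG y n (Suc k) = wz_kernel y n k * ((m - 1) * (q ^ 3 + y) / ((q + 1) * (m ^ 3 - y))
           * ((cert0 p (m + 1) + y * cert1 p (m + 1)) / (p * ((m + 1) ^ 3 - y))))"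
    unfolding wzG_def Let_def kernel_Suc_right m1 by (simp_all add: p_def q_def m_def)
  show ?thesis
    unfolding F G using wz_identity_rational[OF pos(1-3) nz]
    by (simp only: right_diff_distrib[symmetric])
qed

section \<open>The WZ pair of first-order coefficients\<close>

text \<open>
  The derivatives of \<open>wzF\<close> and \<open>wzG\<close> at \<open>y = 0\<close>. In \<open>wzG1\<close>, the terms without harmonic numbers come
  from the occurrences of \<open>y\<close> in the numerator and in the denominator of the certificate.
\<close>

definition wzF1 :: "nat \<Rightarrow> nat \<Rightarrow> real" where
  "wzF1 n k = (3 * real n + 2 * real k + 2) * wz_kernel 0 n k * kernel_log_deriv n k"

definition wzG1 :: "nat \<Rightarrow> nat \<Rightarrow> real" where
  "wzG1 n k = (let p = real n + 1; m = 2 * real n + real k + 2 in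
     wz_kernel 0 n k * ((kernel_log_deriv n k * cert0 p m + cert1 p m) / (p * m ^ 3) + cert0 p m / (p * m ^ 6)))"

lemma has_real_derivative_wzF: "((\<lambda>y. wzF y n k) has_real_derivative wzF1 n k) (at 0)"
  unfolding wzF_def wzF1_def mult.assoc
  by (intro DERIV_cmult has_real_derivative_wz_kernel)

lemma has_real_derivative_wzG: "((\<lambda>y. wzG y n k) has_real_derivative wzG1 n k) (at 0)"
proof -
  define p m where "p = real n + 1" and "m = 2 * real n + real k + 2"
  have pos: "p > 0" "m > 0" by (simp_all add: p_def m_def)
  let ?c = "\<lambda>y. (cert0 p m + y * cert1 p m) / (p * (m ^ 3 - y))"
  have "(?c has_real_derivative cert1 p m / (p * m ^ 3) + cert0 p m / (p * m ^ 6)) (at 0)"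
    using pos by (auto intro!: derivative_eq_intros simp: field_simps power_numeral_reduce)
  from DERIV_mult[OF has_real_derivative_wz_kernel[of n k] this]
  show ?thesis
    unfolding wzG_def wzG1_def Let_def p_def[symmetric] m_def[symmetric]
    by (auto elim!: DERIV_cong simp: algebra_simps add_divide_distrib)
qed

text \<open>
  The two sides of the WZ equation agree on a neighbourhood of \<open>y = 0\<close>, so their derivatives at zero
  agree.
\<close>

lemma wz_pair_first_order: "wzF1 (Suc n) k - wzF1 n k = wzG1 n (Suc k) - wzG1 n k"
proof (rule DERIV_unique)
  show "((\<lambda>y. wzF y (Suc n) k - wzF y n k) has_real_derivative wzF1 (Suc n) k - wzF1 n k) (at 0)"
    by (intro DERIV_diff has_real_derivative_wzF)
  have "eventually (\<lambda>y::real. wzF y (Suc n) k - wzF y n k = wzG y n (Suc k) - wzG y n k) (nhds 0)"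
    using eventually_nhds_in_open[of "{-1<..<1::real}" 0]
    by (auto elim!: eventually_mono intro: wz_pair)
  moreover have "((\<lambda>y. wzG y n (Suc k) - wzG y n k) has_real_derivative
      wzG1 n (Suc k) - wzG1 n k) (at 0)"
    by (intro DERIV_diff has_real_derivative_wzG)
  ultimately show "((\<lambda>y. wzF y (Suc n) k - wzF y n k) has_real_derivative
      wzG1 n (Suc k) - wzG1 n k) (at 0)"
    by (subst DERIV_cong_ev[OF refl _ refl])
qed

section \<open>Decay of the first-order pair\<close>

text \<open>
  At \<open>y = 0\<close> the kernel is a rational function times the inverse square of a binomial coefficient.
  Both limits below follow from the decay of the rational factor alone.
\<close>

lemma kernel_zero:
  "wz_kernel 0 n k = (fact n * fact (n + k) / fact (2 * n + k)) ^ 2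
     / ((real n + real k + 1) * (2 * real n + real k + 1) ^ 3)"
proof -
  have a: "fact (n + k + 1) = (real n + real k + 1) * fact (n + k)"
    "fact (2 * n + k + 1) = (2 * real n + real k + 1) * (fact (2 * n + k) :: real)"
    by (simp_all add: algebra_simps)
  have "w * u ^ 3 * v ^ 3 / (q * v * u * (m * w) ^ 3) = (u * v / w) ^ 2 / (q * m ^ 3)"
    if "u \<noteq> 0" "v \<noteq> 0" "w \<noteq> 0" for u v w q m :: real
    using that by (simp add: field_simps power2_eq_square power3_eq_cube)
  then show ?thesis unfolding wz_kernel_def cube_prod_zero a minus_zero by this simp_all
qed

lemma kernel_zero_bounds:
  "0 \<le> wz_kernel 0 n k"
  "wz_kernel 0 n k \<le> 1 / ((real n + real k + 1) * (2 * real n + real k + 1) ^ 3)"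
proof -
  have "fact n * fact (n + k) dvd (fact (n + (n + k)) :: nat)"
    by (rule fact_fact_dvd_fact)
  then have "fact n * fact (n + k) \<le> (fact (2 * n + k) :: nat)"
    by (auto simp: mult_2 add.assoc intro: dvd_imp_le)
  then have "real (fact n * fact (n + k)) \<le> real (fact (2 * n + k))"
    by (simp only: of_nat_le_iff)
  then have "(fact n * fact (n + k) / fact (2 * n + k) :: real) \<le> 1" by simp
  then have "(fact n * fact (n + k) / fact (2 * n + k) :: real) ^ 2 \<le> 1"
    by (intro power_le_one) auto
  then show "wz_kernel 0 n k \<le> 1 / ((real n + real k + 1) * (2 * real n + real k + 1) ^ 3)"
    unfolding kernel_zero by (intro divide_right_mono) auto
  show "0 \<le> wz_kernel 0 n k" by (simp add: kernel_zero)
qed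

lemma kernel_log_deriv_bounds: "0 \<le> kernel_log_deriv n k" "kernel_log_deriv n k \<le> 3 * riemann_zeta 3"
  using harmonic_num_le_zeta[of 3 n] harmonic_num_le_zeta[of 3 "n + k"]
    harmonic_num_le_zeta[of 3 "2 * n + k + 1"]
  by (simp_all add: kernel_log_deriv_def harmonic_num_nonneg)

text \<open>
  The decay \<open>(2n+k+1)\<^sup>-\<^sup>3\<close> is split between \<open>n\<close> and \<open>k\<close>, so that the sum over \<open>k\<close> is bounded by a
  multiple of \<open>1/(n+1)\<close>.
\<close>

lemma wzF1_bounds:
  "0 \<le> wzF1 n k"
  "wzF1 n k \<le> 9 * riemann_zeta 3 / (real n + 1) * (1 / real (Suc k) ^ 2)"
proof -
  let ?q = "real n + real k + 1" and ?m = "2 * real n + real k + 1"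
  show "0 \<le> wzF1 n k" by (simp add: wzF1_def kernel_zero_bounds kernel_log_deriv_bounds)
  have "wzF1 n k \<le> (3 * ?q) * (1 / (?q * ?m ^ 3)) * (3 * riemann_zeta 3)"
    unfolding wzF1_def using kernel_zero_bounds[of n k] kernel_log_deriv_bounds[of n k]
    by (intro mult_mono) auto
  also have "\<dots> = 9 * riemann_zeta 3 / ?m ^ 3"
  proof -
    have "3 * q * (1 / (q * c)) * (3 * z) = 9 * z / c" if "q \<noteq> 0" for q c z :: real
      using that by simp
    moreover have "?q \<noteq> 0" by linarith
    ultimately show ?thesis .
  qed
  also have "\<dots> \<le> 9 * riemann_zeta 3 / ((real n + 1) * real (Suc k) ^ 2)"
  proof (rule divide_left_mono)
    have "(real n + 1) * real (Suc k) ^ 2 \<le> ?m * ?m ^ 2"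
      by (intro mult_mono power_mono) auto
    then show "(real n + 1) * real (Suc k) ^ 2 \<le> ?m ^ 3"
      by (simp add: power_numeral_reduce)
  qed (use kernel_log_deriv_bounds[of 0 0] in auto)
  finally show "wzF1 n k \<le> 9 * riemann_zeta 3 / (real n + 1) * (1 / real (Suc k) ^ 2)"
    by simp
qed

text \<open>
  As polynomials in \<open>n\<close> and \<open>k\<close>, both parts of the certificate and their differences from \<open>m\<^sup>5\<close> and
  \<open>m\<^sup>2\<close> have nonnegative coefficients.
\<close>

lemma cert_bounds:
  fixes n k :: nat
  defines "p \<equiv> real n + 1" and "m \<equiv> 2 * real n + real k + 2"
  shows "0 \<le> cert0 p m" "cert0 p m \<le> m ^ 5" "0 \<le> cert1 p m" "cert1 p m \<le> m ^ 2"
proof -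
  show "0 \<le> cert1 p m" "cert1 p m \<le> m ^ 2"
    unfolding cert1_def p_def m_def by (simp_all add: algebra_simps power2_eq_square)
  show "0 \<le> cert0 p m" "cert0 p m \<le> m ^ 5"
    unfolding cert0_def p_def m_def by (simp_all add: algebra_simps power_numeral_reduce)
qed

text \<open>
  The kernel decays like \<open>k\<^sup>-\<^sup>4\<close> at least, while the bounds on the certificate show that its cofactor
  grows at most like \<open>k\<^sup>2\<close>. For a null sequence the cruder bound \<open>O(1/k)\<close> is enough.
\<close>

lemma wzG1_tendsto_0: "wzG1 n \<longlonglongrightarrow> 0"
proof (rule tendsto_sandwich)
  let ?C = "3 * riemann_zeta 3 + 2"
  show "eventually (\<lambda>k. 0 \<le> wzG1 n k) sequentially"
    by (simp add: wzG1_def Let_def cert_bounds kernel_zero_bounds kernel_log_deriv_bounds)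
  have Z: "riemann_zeta 3 \<ge> 0" using kernel_log_deriv_bounds[of 0 0] by linarith
  show "eventually (\<lambda>k. wzG1 n k \<le> 4 * ?C / real (Suc k)) sequentially"
  proof (rule always_eventually, rule allI)
    fix k
    define p m where "p = real n + 1" and "m = 2 * real n + real k + 2"
    have pos: "p \<ge> 1" "m \<ge> 2" "m > 0" by (simp_all add: p_def m_def)
    note c = cert_bounds[of n k, folded p_def m_def]
    have "(kernel_log_deriv n k * cert0 p m + cert1 p m) / (p * m ^ 3) + cert0 p m / (p * m ^ 6)
       \<le> (3 * riemann_zeta 3 * m ^ 5 + m ^ 2) / (1 * m ^ 3) + m ^ 5 / (1 * m ^ 6)"
      using c kernel_log_deriv_bounds[of n k] pos Z
      by (intro add_mono frac_le mult_mono mult_nonneg_nonneg add_nonneg_nonneg) auto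
    also have "\<dots> = 3 * riemann_zeta 3 * m ^ 2 + 2 / m"
      using pos by (simp add: field_simps power_numeral_reduce)
    also have "\<dots> \<le> 3 * riemann_zeta 3 * m ^ 2 + 2 * m ^ 2"
      using pos one_le_power[of m 3]
      by (simp add: field_simps power_numeral_reduce)
    finally have b: "(kernel_log_deriv n k * cert0 p m + cert1 p m) / (p * m ^ 3) + cert0 p m / (p * m ^ 6)
       \<le> ?C * m ^ 2" by (simp add: algebra_simps)
    have "wzG1 n k \<le> 1 / ((real n + real k + 1) * (2 * real n + real k + 1) ^ 3) * (?C * m ^ 2)"
      unfolding wzG1_def Let_def p_def[symmetric] m_def[symmetric]
      using kernel_zero_bounds[of n k] b c kernel_log_deriv_bounds[of n k] pos
      by (intro mult_mono) auto
    also have "\<dots> = ?C * m ^ 2 / ((real n + real k + 1) * (m - 1) ^ 3)"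
    proof -
      have "m - 1 = 2 * real n + real k + 1" by (simp add: m_def)
      then show ?thesis by (simp only:) simp
    qed
    also have "\<dots> \<le> ?C * (2 * (m - 1)) ^ 2 / (real (Suc k) * (m - 1) ^ 2)"
    proof (rule frac_le)
      show "real (Suc k) * (m - 1) ^ 2 \<le> (real n + real k + 1) * (m - 1) ^ 3"
        using pos by (intro mult_mono power_increasing) auto
    qed (use pos Z in \<open>auto intro!: mult_left_mono power_mono\<close>)
    also have "\<dots> = 4 * ?C / real (Suc k)"
    proof -
      have "c * (2 * u) ^ 2 / (v * u ^ 2) = 4 * c / v" if "u \<noteq> 0" for c u v :: real
        using that by (simp add: power_mult_distrib)
      moreover have "m - 1 \<noteq> 0" using pos by simp
      ultimately show ?thesis .
    qed
    finally show "wzG1 n k \<le> 4 * ?C / real (Suc k)" .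
  qed
  show "(\<lambda>k. 4 * ?C / real (Suc k)) \<longlonglongrightarrow> 0"
    using tendsto_mult[OF tendsto_const[of "4 * ?C"] LIMSEQ_inverse_real_of_nat]
    by (simp add: divide_inverse)
qed auto

section \<open>Summation over rectangles\<close>

text \<open>
  With \<open>H\<^sub>k\<close> the harmonic numbers of order three, \<open>wzF1 0 k\<close> is \<open>2 (H\<^sub>k + H\<^bsub>k+1\<^esub>)/(k+1)\<^sup>3\<close>, and
  \<open>1/(k+1)\<^sup>3 = H\<^bsub>k+1\<^esub> - H\<^sub>k\<close> makes it twice a difference of squares.
\<close>

lemma wzF1_0_sum: "(\<Sum>k<K. wzF1 0 k) = 2 * harmonic_num 3 K ^ 2"
proof (induction K)
  case (Suc K)
  have "wzF1 0 K = 2 * harmonic_num 3 (Suc K) ^ 2 - 2 * harmonic_num 3 K ^ 2"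
    by (simp add: wzF1_def kernel_zero kernel_log_deriv_def divide_simps)
       (simp add: algebra_simps power_numeral_reduce)
  with Suc show ?case by simp
qed simp

text \<open>
  Summing the WZ equation over the rectangle \<open>n < N\<close>, \<open>k < K\<close> leaves only the four sides.
\<close>

lemma wz_finite_sum:
  "(\<Sum>n<N. wzG1 n 0) = 2 * harmonic_num 3 K ^ 2 - (\<Sum>k<K. wzF1 N k) + (\<Sum>n<N. wzG1 n K)"
proof -
  have "(\<Sum>n<N. wzG1 n K) - (\<Sum>n<N. wzG1 n 0) = (\<Sum>n<N. \<Sum>k<K. wzG1 n (Suc k) - wzG1 n k)"
    by (simp add: sum_subtractf[symmetric] sum_lessThan_telescope)
  also have "\<dots> = (\<Sum>k<K. \<Sum>n<N. wzF1 (Suc n) k - wzF1 n k)"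
    by (subst sum.swap) (simp add: wz_pair_first_order)
  also have "\<dots> = (\<Sum>k<K. wzF1 N k) - 2 * harmonic_num 3 K ^ 2"
  proof -
    have "(\<Sum>n<N. wzF1 (Suc n) k - wzF1 n k) = wzF1 N k - wzF1 0 k" for k
      by (rule sum_lessThan_telescope)
    then have "(\<Sum>k<K. \<Sum>n<N. wzF1 (Suc n) k - wzF1 n k) = (\<Sum>k<K. wzF1 N k - wzF1 0 k)"
      by (simp only:)
    then show ?thesis by (simp only: sum_subtractf[of "wzF1 N" "wzF1 0"] wzF1_0_sum)
  qed
  finally show ?thesis by simp
qed

text \<open>
  For fixed \<open>N\<close> the limit \<open>K \<rightarrow> \<infinity>\<close> removes the side \<open>k = K\<close> of the rectangle. The side \<open>n = N\<close> is
  \<open>O(1/N)\<close> uniformly in \<open>K\<close>, so the partial sums differ from their limit by at most that much.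
\<close>

lemma wzG1_0_sums: "(\<lambda>n. wzG1 n 0) sums (2 * riemann_zeta 3 ^ 2)"
proof -
  let ?Z = "riemann_zeta 3"
  define B where "B = 9 * ?Z * (\<Sum>k. 1 / real (Suc k) ^ 2)"
  have Z: "?Z \<ge> 0" using kernel_log_deriv_bounds[of 0 0] by linarith
  have H: "harmonic_num 3 \<longlonglongrightarrow> ?Z" using harmonic_num_tendsto_zeta[of 3] by simp
  have bound: "\<bar>(\<Sum>n<N. wzG1 n 0) - 2 * ?Z ^ 2\<bar> \<le> B * (1 / (real N + 1))" for N
  proof -
    have F: "\<bar>\<Sum>k<K. wzF1 N k\<bar> \<le> B * (1 / (real N + 1))" for K
    proof -
      have "(\<Sum>k<K. wzF1 N k) \<le> (\<Sum>k<K. 9 * ?Z / (real N + 1) * (1 / real (Suc k) ^ 2))"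
        by (intro sum_mono wzF1_bounds)
      also have "\<dots> = 9 * ?Z / (real N + 1) * (\<Sum>k<K. 1 / real (Suc k) ^ 2)"
        by (simp only: sum_distrib_left)
      also have "\<dots> \<le> 9 * ?Z / (real N + 1) * (\<Sum>k. 1 / real (Suc k) ^ 2)"
        using Z by (intro mult_left_mono sum_le_suminf summable_inverse_Suc_power) auto
      also have "\<dots> = B * (1 / (real N + 1))"
        by (simp only: B_def times_divide_eq_left times_divide_eq_right mult_1_right mult_ac)
      finally have "(\<Sum>k<K. wzF1 N k) \<le> B * (1 / (real N + 1))" .
      moreover have "(\<Sum>k<K. wzF1 N k) \<ge> 0" by (intro sum_nonneg wzF1_bounds)
      ultimately show ?thesis by (simp only: abs_of_nonneg)
    qed
    have lim: "(\<lambda>K. (\<Sum>n<N. wzG1 n 0) - 2 * harmonic_num 3 K ^ 2 - (\<Sum>n<N. wzG1 n K))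
        \<longlonglongrightarrow> (\<Sum>n<N. wzG1 n 0) - 2 * ?Z ^ 2 - (\<Sum>n<N. 0)"
      by (intro tendsto_diff tendsto_const tendsto_mult tendsto_power tendsto_sum wzG1_tendsto_0 H)
    have le: "\<bar>(\<Sum>n<N. wzG1 n 0) - 2 * harmonic_num 3 K ^ 2 - (\<Sum>n<N. wzG1 n K)\<bar>
        \<le> B * (1 / (real N + 1))" for K
      using F[of K] wz_finite_sum[of N K] by linarith
    have "\<bar>(\<Sum>n<N. wzG1 n 0) - 2 * ?Z ^ 2 - (\<Sum>n<N. 0)\<bar> \<le> B * (1 / (real N + 1))"
      by (rule tendsto_upperbound[OF tendsto_rabs[OF lim]])
         (simp_all only: le eventually_True trivial_limit_sequentially not_False_eq_True)
    then show ?thesis by simp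
  qed
  have "(\<lambda>N. B * (1 / (real N + 1))) \<longlonglongrightarrow> B * 0"
    using LIMSEQ_inverse_real_of_nat
    by (intro tendsto_mult tendsto_const) (simp add: inverse_eq_divide add.commute)
  then have "(\<lambda>N. (\<Sum>n<N. wzG1 n 0) - 2 * ?Z ^ 2) \<longlonglongrightarrow> 0"
    unfolding mult_zero_right
    by (rule Lim_null_comparison[rotated]) (use bound in \<open>simp only: real_norm_def eventually_True\<close>)
  then show ?thesis unfolding sums_def by (rule LIM_zero_cancel)
qed

lemma kernel_zero_central_binomial:
  "wz_kernel 0 n 0 = 4 / (real (Suc n) ^ 3 * (2 * real n + 1) * real ((2 * Suc n) choose Suc n) ^ 2)"
proof -
  have "real ((2 * Suc n) choose Suc n) = fact (2 * Suc n) / (fact (Suc n) * fact (Suc n))"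
  proof -
    have "2 * Suc n - Suc n = Suc n" "Suc n \<le> 2 * Suc n" by simp_all
    then show ?thesis
      using binomial_fact[of "Suc n" "2 * Suc n", where 'a = real] by (simp only:)
  qed
  also have "\<dots> = 2 * (2 * real n + 1) / real (Suc n) * (fact (2 * n) / (fact n * fact n))"
  proof -
    have f: "fact (2 * Suc n) = 2 * real (Suc n) * ((2 * real n + 1) * fact (2 * n))"
      "fact (Suc n) = real (Suc n) * (fact n :: real)"
      by (simp_all add: algebra_simps)
    have "2 * s * (r * w) / (s * u * (s * u)) = 2 * r / s * (w / (u * u))"
      if "s \<noteq> 0" for r s u w :: real
      using that by (simp add: mult_ac)
    then show ?thesis unfolding f by this simp
  qed
  finally have b: "real ((2 * Suc n) choose Suc n)
      = 2 * (2 * real n + 1) / real (Suc n) * (fact (2 * n) / (fact n * fact n))" .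
  have *: "(u * u / w) ^ 2 / (s * r ^ 3) = 4 / (s ^ 3 * r * (2 * r / s * (w / (u * u))) ^ 2)"
    if "s \<noteq> 0" "r \<noteq> 0" "u \<noteq> 0" "w \<noteq> 0" for r s u w :: real
    using that
    by (simp add: power_mult_distrib power_divide)
       (simp add: divide_simps power2_eq_square power3_eq_cube)
  have "wz_kernel 0 n 0 = (fact n * fact n / fact (2 * n)) ^ 2
      / (real (Suc n) * (2 * real n + 1) ^ 3)"
    by (simp add: kernel_zero add.commute)
  also have "\<dots> = 4 / (real (Suc n) ^ 3 * (2 * real n + 1)
      * (2 * (2 * real n + 1) / real (Suc n) * (fact (2 * n) / (fact n * fact n))) ^ 2)"
    by (rule *) auto
  finally show ?thesis unfolding b .
qed

text \<open>
  The harmonic numbers in \<open>kernel_log_deriv n 0\<close> have the indices \<open>k - 1\<close>, \<open>k - 1\<close> and \<open>2k - 1\<close>. The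
  rational terms that come from differentiating the certificate add up to the multiple of \<open>1/k\<^sup>4\<close>.
\<close>

lemma wzG1_0:
  fixes n :: nat
  defines "k \<equiv> Suc n"
  shows "2 * wzG1 n 0 = 1 / (real k ^ 2 * real ((2 * k) choose k) ^ 2) *
      ((30 * real k - 11) / (real k * (2 * real k - 1)) *
         (harmonic_num 3 (2 * k - 1) + 2 * harmonic_num 3 (k - 1))
       + 27 / (8 * real k ^ 4))"
proof -
  define x h c where "x = real k" and "h = kernel_log_deriv n 0" and "c = real ((2 * k) choose k)"
  define r where "r = 2 * x - 1"
  have x: "x > 0" "r > 0" by (simp_all add: r_def x_def k_def)
  have c: "c > 0" by (simp add: c_def zero_less_binomial del: binomial_Suc_Suc)
  have n: "real n + 1 = x" "2 * real n + real 0 + 2 = 2 * x" "2 * real n + 1 = 2 * x - 1"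
    by (simp_all add: x_def k_def)
  have h: "harmonic_num 3 (2 * k - 1) + 2 * harmonic_num 3 (k - 1) = h"
    by (simp add: h_def kernel_log_deriv_def k_def)
  have cert: "cert0 x (2 * x) = x ^ 4 * (30 * x - 11)" "cert1 x (2 * x) = x * (3 * x - 2)"
    by (simp_all add: cert0_def cert1_def algebra_simps power_numeral_reduce)
  have kern: "wz_kernel 0 n 0 = 4 / (x ^ 3 * (2 * x - 1) * c ^ 2)"
    unfolding kernel_zero_central_binomial n k_def[symmetric] by (simp add: x_def c_def)
  have "(h * (x ^ 4 * (30 * x - 11)) + x * (3 * x - 2)) / (x * (2 * x) ^ 3)
      + x ^ 4 * (30 * x - 11) / (x * (2 * x) ^ 6) = (30 * x - 11) * h / 8 + 27 * r / (64 * x ^ 3)"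
    using x(1) unfolding r_def
    by (simp add: divide_simps) (simp add: algebra_simps power_numeral_reduce)
  moreover have "2 * (4 / (x ^ 3 * r * c ^ 2) * (w * h / 8 + 27 * r / (64 * x ^ 3)))
      = 1 / (x ^ 2 * c ^ 2) * (w / (x * r) * h + 27 / (8 * x ^ 4))" for w
    using x c by (simp add: divide_simps) (simp add: algebra_simps power_numeral_reduce)
  ultimately show ?thesis
    unfolding wzG1_def Let_def n cert kern h h_def[symmetric] x_def[symmetric] c_def[symmetric]
      r_def[symmetric]
    by (simp only:)
qed

theorem theorem1p5:
  "(\<lambda>i. let k = Suc i in
      1 / (real k ^ 2 * real ((2 * k) choose k) ^ 2) *
      ((30 * real k - 11) / (real k * (2 * real k - 1)) *
         (harmonic_num 3 (2 * k - 1) + 2 * harmonic_num 3 (k - 1))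
       + 27 / (8 * real k ^ 4)))
   sums (4 * (riemann_zeta 3) ^ 2)"
  using sums_mult[OF wzG1_0_sums, of 2] by (simp only: wzG1_0 Let_def) simp

end
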